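(* Let $\varphi\not\equiv 0\pmod{2\pi}$. Let $B$, $C$, $D$ be points on the $z$-axis in $\mathbb R^3$, and let $A^{(1)},A^{(2)}\in\mathbb R^3$ be points such that $A^{(2)}$ is obtained from $A^{(1)}$ by the rotation about the $z$-axis through the angle $\varphi$, where all the tetrahedra below have nonzero volume. Consider the move $1\to2$ which replaces the tetrahedron $BDAA$ by the two tetrahedra $BCAA$ and $CDAA$ (where $C$ is a new point taken in the edge $BD$), and let $\tau_1$ and $\tau_2$ be the torsions of the acyclic complexes $$0\to 0\to (dl_{BD})\to(d\omega_{BD})\to 0\to 0$$ and $$0\to(dz_C)\to(dl_{BC},dl_{CD},dl_{AC})\to(d\omega_{BC},d\omega_{CD},d\omega_{AC})\to(dz_C)^{*}\to 0,$$ respectively, as described in the context. Then $$\frac{\tau_2}{\tau_1}=\frac{6V_{CA^{(1)}A^{(2)}B}\cdot 6V_{DA^{(1)}A^{(2)}C}}{2(1-\cos\varphi)\cdot l_{AC}^2\cdot 6V_{DA^{(1)}A^{(2)}B}}.$$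
   Context: **Setting.** In a pseudotriangulation of $S^3$ with a knot $K$ going along some of its edges (the boundary of a simplex may contain the same lower-dimensional simplex several times), there is a tetrahedron $BDAA$ whose edge $BD$ lies on $K$ and whose edge $AA$, with coinciding ends, winds one time around $K$. A representation $f\colon\pi(K)\to \mathrm{SO}(3)$ of the knot group takes the passing along $AA$ to the rotation about the $z$-axis through the angle $\varphi$. When lifted to the branched covering corresponding to $f$, the beginning and end of the edge $AA$ become the different points $A^{(1)}$ and $A^{(2)}$, with coordinates in $\mathbb R^3$ related by this rotation, while $B$, $C$, $D$ lie on the $z$-axis. The faces $BDA^{(1)}$ and $BDA^{(2)}$ of the tetrahedron $BDA^{(1)}A^{(2)}$ are glued together, so $BD$ belongs only to this tetrahedron; likewise, after the move, $BC$ belongs only to $BCAA$, $CD$ only to $CDAA$, and the edge $AC$, which is represented both by $CA^{(1)}$ and by $CA^{(2)}$, belongs only to these two tetrahedra. Each edge has a single length: $l_{AB}=|A^{(i)}B|$, $l_{AC}=|A^{(i)}C|$, $l_{AD}=|A^{(i)}D|$ for $i=1,2$, $l_{AA}=|A^{(1)}A^{(2)}|$. **Signs and deficit angles.** The oriented volume is $V_{PQRS}=\frac16\,\overrightarrow{PQ}\cdot(\overrightarrow{PR}\times\overrightarrow{PS})$. The tetrahedra are oriented consistently, here as $DA^{(1)}A^{(2)}B$, $CA^{(1)}A^{(2)}B$ and $DA^{(1)}A^{(2)}C$, and all dihedral angles of a tetrahedron are taken with the sign of its oriented volume. The deficit angle $\omega_b$ around an edge $b$ is minus the algebraic sum of the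 (signed) dihedral angles at $b$ in all tetrahedra containing $b$ (for $b=AC$: the dihedral angles at both $CA^{(1)}$ and $CA^{(2)}$ in both new tetrahedra), as a function of the edge lengths. **The complexes.** In the first complex the map $(dl_{BD})\to(d\omega_{BD})$ is $\partial\omega_{BD}/\partial l_{BD}$, computed in the tetrahedron $BDAA$ with the other lengths $l_{AB},l_{AD},l_{AA}$ fixed, so $\tau_1=(\partial\omega_{BD}/\partial l_{BD})^{-1}$. In the second complex, $(dz_C)$ is the one-dimensional space of the differential of the coordinate $z_C$ of $C$; the first map is the column of derivatives $\partial l/\partial z_C$ of $l_{BC},l_{CD},l_{AC}$; the second is the symmetric $3\times3$ matrix of partial derivatives of $\omega_{BC},\omega_{CD},\omega_{AC}$ with respect to $l_{BC},l_{CD},l_{AC}$, with $l_{AB},l_{AD},l_{AA}$ fixed, evaluated at the lengths given by the coordinates; the third is the transpose of the first, and $(dz_C)^{*}$ denotes the one-dimensional term symmetric to $(dz_C)$. Its torsion is $$\tau_2=\frac{(\partial l_a/\partial z_C)^2}{\operatorname{minor}(\partial\omega/\partial l)},$$ where $a$ is one of the edges $BC,CD,AC$ with $\partial l_a/\partial z_C\ne0$, and the minor is the $2\times2$ minor of $(\partial\omega/\partial l)$ with rows and columns corresponding to the other two edges. *)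

theory Defs
  imports "HOL-Analysis.Analysis"
begin

definition z_axis :: "(real^3) set" where
  "z_axis = {p. p $ 1 = 0 \<and> p $ 2 = 0}"

definition z_point :: "real \<Rightarrow> real^3" where
  "z_point z = vector [0, 0, z]"

definition rotation_z :: "real \<Rightarrow> real^3 \<Rightarrow> real^3" where
  "rotation_z \<phi> p = vector [cos \<phi> * p $ 1 - sin \<phi> * p $ 2, sin \<phi> * p $ 1 + cos \<phi> * p $ 2, p $ 3]"

definition oriented_volume :: "real^3 \<Rightarrow> real^3 \<Rightarrow> real^3 \<Rightarrow> real^3 \<Rightarrow> real" where
  "oriented_volume P Q R S = ((Q - P) \<bullet> cross3 (R - P) (S - P)) / 6"

text \<open>The unsigned dihedral angle, in the interval from 0 to \<open>pi\<close>, at the edge \<open>PQ\<close> of the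
  tetrahedron \<open>PQRS\<close>.  The two normals are the components of \<open>R - P\<close> and \<open>S - P\<close> orthogonal
  to \<open>PQ\<close>, both turned by a right angle about \<open>PQ\<close> and scaled by the length of \<open>PQ\<close>, so
  the angle between them is the interior one.\<close>

definition dihedral_angle :: "real^3 \<Rightarrow> real^3 \<Rightarrow> real^3 \<Rightarrow> real^3 \<Rightarrow> real" where
  "dihedral_angle P Q R S =
     (let m = cross3 (Q - P) (R - P); n = cross3 (Q - P) (S - P)
      in arccos ((m \<bullet> n) / (norm m * norm n)))"

text \<open>The same angle as a function of the six edge lengths, in the order
  \<open>PQ, PR, PS, QR, QS, RS\<close> (so the angle is the one at the edge of length \<open>lPQ\<close>).  Tetrahedra with
  equal edge lengths are congruent, so the description is unique wherever the lengths are realized;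
  this includes a neighbourhood of the lengths of any nondegenerate tetrahedron.\<close>

definition dihedral_of_lengths :: "real \<Rightarrow> real \<Rightarrow> real \<Rightarrow> real \<Rightarrow> real \<Rightarrow> real \<Rightarrow> real" where
  "dihedral_of_lengths lPQ lPR lPS lQR lQS lRS =
     (THE \<theta>. \<exists>P Q R S :: real^3.
        dist P Q = lPQ \<and> dist P R = lPR \<and> dist P S = lPS \<and>
        dist Q R = lQR \<and> dist Q S = lQS \<and> dist R S = lRS \<and>
        \<theta> = dihedral_angle P Q R S)"

text \<open>Throughout, \<open>A1\<close> and \<open>A2\<close> are the two lifts of the vertex \<open>A\<close>; the single length \<open>l_AX\<close> is
  read off from \<open>A1\<close>, the points \<open>A1\<close> and \<open>A2\<close> being at equal distance from every point \<open>X\<close> of the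
  axis.  Edge lengths do not determine the orientation of a tetrahedron, so when lengths vary the
  sign of its dihedral angles is kept as in the given configuration, where the volume is nonzero.\<close>

definition deficit_BD ::
  "real^3 \<Rightarrow> real^3 \<Rightarrow> real^3 \<Rightarrow> real^3 \<Rightarrow> real \<Rightarrow> real" where
  "deficit_BD A1 A2 B D lBD =
     (let lAB = dist A1 B; lAD = dist A1 D; lAA = dist A1 A2
      in - (sgn (oriented_volume D A1 A2 B) * dihedral_of_lengths lBD lAB lAB lAD lAD lAA))"

text \<open>The edges \<open>BC\<close>, \<open>CD\<close>, \<open>AC\<close> whose lengths vary after the move.\<close>

datatype new_edge = BC | CD | AC

lemma UNIV_new_edge: "UNIV = {BC, CD, AC}"
  using new_edge.exhaust by auto

instance new_edge :: finite
  by standard (simp add: UNIV_new_edge)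

text \<open>In \<open>deficit_new\<close> the edge \<open>AC\<close> collects four terms: the angles at \<open>C A1\<close> and at \<open>C A2\<close>
  in each of the two tetrahedra.  Because \<open>A1\<close> and \<open>A2\<close> have the same distances to the other
  vertices, the two terms belonging to one tetrahedron are the same function of the lengths.\<close>

definition deficit_new ::
  "real^3 \<Rightarrow> real^3 \<Rightarrow> real^3 \<Rightarrow> real^3 \<Rightarrow> real^3 \<Rightarrow> real^new_edge \<Rightarrow> real^new_edge" where
  "deficit_new A1 A2 B C D l =
     (let lAB = dist A1 B; lAD = dist A1 D; lAA = dist A1 A2;
          lBC = l $ BC; lCD = l $ CD; lAC = l $ AC;
          sB = sgn (oriented_volume C A1 A2 B);
          sD = sgn (oriented_volume D A1 A2 C)
      in \<chi> e. case e of
           BC \<Rightarrow> - (sB * dihedral_of_lengths lBC lAB lAB lAC lAC lAA)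
         | CD \<Rightarrow> - (sD * dihedral_of_lengths lCD lAC lAC lAD lAD lAA)
         | AC \<Rightarrow> - (sB * dihedral_of_lengths lAC lAC lBC lAA lAB lAB
                  + sB * dihedral_of_lengths lAC lAC lBC lAA lAB lAB
                  + sD * dihedral_of_lengths lAC lAC lCD lAA lAD lAD
                  + sD * dihedral_of_lengths lAC lAC lCD lAA lAD lAD))"

definition new_lengths :: "real^3 \<Rightarrow> real^3 \<Rightarrow> real^3 \<Rightarrow> real^3 \<Rightarrow> real^new_edge" where
  "new_lengths A1 B D C =
     (\<chi> e. case e of BC \<Rightarrow> dist B C | CD \<Rightarrow> dist C D | AC \<Rightarrow> dist A1 C)"

definition d_omega_BD :: "real^3 \<Rightarrow> real^3 \<Rightarrow> real^3 \<Rightarrow> real^3 \<Rightarrow> real" where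
  "d_omega_BD A1 A2 B D = deriv (deficit_BD A1 A2 B D) (dist B D)"

definition d_lengths :: "real^3 \<Rightarrow> real^3 \<Rightarrow> real^3 \<Rightarrow> real^3 \<Rightarrow> real^new_edge" where
  "d_lengths A1 B D C = (\<chi> e. deriv (\<lambda>z. new_lengths A1 B D (z_point z) $ e) (C $ 3))"

definition d_omega_new ::
  "real^3 \<Rightarrow> real^3 \<Rightarrow> real^3 \<Rightarrow> real^3 \<Rightarrow> real^3 \<Rightarrow> real^new_edge^new_edge" where
  "d_omega_new A1 A2 B C D =
     (let l = new_lengths A1 B D C
      in \<chi> i j. deriv (\<lambda>x. deficit_new A1 A2 B C D (\<chi> k. if k = j then x else l $ k) $ i) (l $ j))"

text \<open>The complex \<open>0 \<rightarrow> 0 \<rightarrow> \<real> \<rightarrow> \<real> \<rightarrow> 0 \<rightarrow> 0\<close> whose middle map is multiplication by \<open>d\<close>.\<close>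

definition acyclic_1 :: "real \<Rightarrow> bool" where
  "acyclic_1 d \<longleftrightarrow> bij (\<lambda>t. d * t)"

definition torsion_1 :: "real \<Rightarrow> real" where
  "torsion_1 d = inverse d"

text \<open>The complex \<open>0 \<rightarrow> \<real> \<rightarrow> \<real>\<^sup>3 \<rightarrow> \<real>\<^sup>3 \<rightarrow> \<real> \<rightarrow> 0\<close> whose maps are the column \<open>v\<close>, the
  matrix \<open>M\<close> and the transpose of \<open>v\<close>: exactness at each of the four terms.\<close>

definition acyclic_2 :: "real^new_edge \<Rightarrow> real^new_edge^new_edge \<Rightarrow> bool" where
  "acyclic_2 v M \<longleftrightarrow>
     inj (\<lambda>t::real. t *\<^sub>R v) \<and>
     range (\<lambda>t::real. t *\<^sub>R v) = {x. M *v x = 0} \<and>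
     range (\<lambda>x. M *v x) = {y. v \<bullet> y = 0} \<and>
     surj (\<lambda>y. v \<bullet> y)"

definition principal_minor :: "real^new_edge^new_edge \<Rightarrow> new_edge \<Rightarrow> new_edge \<Rightarrow> real" where
  "principal_minor M i j = M $ i $ i * M $ j $ j - M $ i $ j * M $ j $ i"

definition minor_of_others :: "real^new_edge^new_edge \<Rightarrow> new_edge \<Rightarrow> real" where
  "minor_of_others M a =
     (case a of BC \<Rightarrow> principal_minor M CD AC
              | CD \<Rightarrow> principal_minor M BC AC
              | AC \<Rightarrow> principal_minor M BC CD)"

text \<open>The torsion of the second complex computed with the chosen edge \<open>a\<close>; it is meant for an
  acyclic complex and \<open>v $ a \<noteq> 0\<close>.\<close>

definition torsion_2 :: "real^new_edge \<Rightarrow> real^new_edge^new_edge \<Rightarrow> new_edge \<Rightarrow> real" where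
  "torsion_2 v M a = (v $ a)\<^sup>2 / minor_of_others M a"

end

theory Submission
  imports Defs
begin

text \<open>
  Everything reduces to one kind of tetrahedron: an edge \<open>XY\<close> of length \<open>u\<close> on the axis, and two
  apexes \<open>A1\<close>, \<open>A2\<close>, both at distance \<open>p\<close> from \<open>X\<close> and \<open>q\<close> from \<open>Y\<close>, with \<open>A1 A2\<close> of length \<open>s\<close>.
  Let \<open>h\<close> be the squared distance from the apexes to the line \<open>XY\<close>.  The dihedral angle \<open>\<theta>\<close> at \<open>XY\<close>
  is the apex angle of an isosceles triangle with legs \<open>sqrt h\<close> and base \<open>s\<close>, so
  \<open>cos \<theta> = 1 - s\<^sup>2 / (2 h)\<close>; the angle at \<open>Y A1\<close> has a similar closed form.  Here \<open>h\<close> is a rational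
  function of \<open>u\<close>, \<open>p\<close>, \<open>q\<close>, so all partial derivatives can be written out.  At the given
  configuration they simplify greatly, because \<open>h\<close> is then the same number for all three
  tetrahedra, and so is the factor \<open>g = s / (h sqrt (4 h - s\<^sup>2)) = (1 - cos \<phi>) / (h \<bar>sin \<phi>\<bar>)\<close>
  that all derivatives share.  The result (\<open>DERIV_dihedral_over_axis\<close>) expresses them through the
  heights \<open>a\<close>, \<open>b\<close>, \<open>c\<close>, \<open>d\<close> of \<open>A\<close>, \<open>B\<close>, \<open>C\<close>, \<open>D\<close> along the axis.

  Let \<open>M\<close> be the matrix of the derivatives of the deficit angles and \<open>v\<close> the column of the derivatives
  of the lengths.  The explicit entries show that \<open>M\<close> is symmetric, that \<open>M v = 0\<close> (moving \<open>C\<close> along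
  the axis preserves all deficit angles), and that the \<open>BC\<close>, \<open>CD\<close> entry vanishes, as no tetrahedron
  contains both edges.  These three properties alone force each minor to be \<open>\<kappa> v\<^sub>a\<^sup>2\<close> with
  \<open>\<kappa> = M\<^bsub>BC,AC\<^esub> M\<^bsub>CD,AC\<^esub> / (v\<^bsub>BC\<^esub> v\<^bsub>CD\<^esub>)\<close> (\<open>torsion_minors\<close>), and a nonzero minor gives exactness
  (\<open>acyclic_2I\<close>).  Hence \<open>\<tau>\<^sub>2 = 1 / \<kappa>\<close> for every choice of the edge \<open>a\<close>.

  Finally \<open>\<kappa>\<close> and \<open>1 / \<tau>\<^sub>1\<close> both contain the factor \<open>(b - a) (a - d)\<close>, which cancels from the ratio;
  its nonvanishing is what the acyclicity of the first complex says.  What remains is a product of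
  \<open>b - c\<close>, \<open>c - d\<close>, \<open>1 / (b - d)\<close> and constants, and each such difference is \<open>6 V / (h sin \<phi>)\<close>
  for the volume of one of the tetrahedra.
\<close>

section \<open>Linear algebra of the second complex\<close>

text \<open>
  The adjugate of a symmetric matrix of corank one is a multiple of \<open>v v\<^sup>T\<close>, where \<open>v\<close> spans the
  kernel; the zero entry makes the multiple explicit.  Working with the rows of \<open>M v = 0\<close> avoids
  division by \<open>v $ AC\<close>, which is zero when \<open>C\<close> is the foot of the perpendicular from \<open>A\<close>.
\<close>

lemma torsion_minors:
  fixes M :: "real^new_edge^new_edge" and v :: "real^new_edge"
  assumes sym: "transpose M = M" and ker: "M *v v = 0"
    and zero: "M $ BC $ CD = 0" and v: "v $ BC \<noteq> 0" "v $ CD \<noteq> 0"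
  shows "minor_of_others M a = M $ BC $ AC * M $ CD $ AC / (v $ BC * v $ CD) * (v $ a)\<^sup>2"
proof -
  have s: "M $ i $ j = M $ j $ i" for i j
    using sym by (metis transpose_def vec_lambda_beta)
  have rows: "M $ i $ BC * v $ BC + M $ i $ CD * v $ CD + M $ i $ AC * v $ AC = 0" for i
    using arg_cong[OF ker, of "\<lambda>x. x $ i"]
    by (simp add: matrix_vector_mult_def UNIV_new_edge algebra_simps)
  have rBC: "M $ BC $ BC * v $ BC = - (M $ BC $ AC * v $ AC)"
    using rows[of BC] zero by simp
  have rCD: "M $ CD $ CD * v $ CD = - (M $ CD $ AC * v $ AC)"
    using rows[of CD] zero s[of BC CD] by simp
  have rAC: "M $ AC $ AC * v $ AC = - (M $ BC $ AC * v $ BC) - M $ CD $ AC * v $ CD"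
    using rows[of AC] s[of AC BC] s[of AC CD] by simp
  show ?thesis
  proof (cases a)
    case BC
    have "(M $ CD $ CD * M $ AC $ AC - (M $ CD $ AC)\<^sup>2) * v $ CD = M $ BC $ AC * M $ CD $ AC * v $ BC"
      using rCD rAC by algebra
    then show ?thesis
      using v s[of AC CD] BC
      by (simp add: minor_of_others_def principal_minor_def field_simps power2_eq_square)
  next
    case CD
    have "(M $ BC $ BC * M $ AC $ AC - (M $ BC $ AC)\<^sup>2) * v $ BC = M $ BC $ AC * M $ CD $ AC * v $ CD"
      using rBC rAC by algebra
    then show ?thesis
      using v s[of AC BC] CD
      by (simp add: minor_of_others_def principal_minor_def field_simps power2_eq_square)
  next
    case AC
    have "M $ BC $ BC * M $ CD $ CD * (v $ BC * v $ CD) = M $ BC $ AC * M $ CD $ AC * (v $ AC)\<^sup>2"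
      using rBC rCD by algebra
    then show ?thesis
      using v zero AC
      by (simp add: minor_of_others_def principal_minor_def field_simps power2_eq_square)
  qed
qed

text \<open>
  A nonzero complementary minor gives \<open>M\<close> rank at least two; the kernel is then the line of \<open>v\<close>, and
  by symmetry the image is its orthogonal complement.  Both inclusions are solved by Cramer's rule
  on the block complementary to \<open>BC\<close>.
\<close>

lemma acyclic_2I:
  fixes M :: "real^new_edge^new_edge" and v :: "real^new_edge"
  assumes sym: "transpose M = M" and ker: "M *v v = 0"
    and v: "v $ BC \<noteq> 0" and minor: "minor_of_others M BC \<noteq> 0"
  shows "acyclic_2 v M"
  unfolding acyclic_2_def
proof (intro conjI)
  have v0: "v \<noteq> 0" using v by auto
  have dot: "v \<bullet> (M *v x) = 0" for x
    by (metis dot_lmul_matrix inner_zero_left ker sym vector_transpose_matrix)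
  define m where "m = minor_of_others M BC"
  have m: "m = M $ CD $ CD * M $ AC $ AC - M $ CD $ AC * M $ AC $ CD" "m \<noteq> 0"
    using minor by (simp_all add: m_def minor_of_others_def principal_minor_def)
  have ent: "(M *v x) $ i = M $ i $ BC * x $ BC + M $ i $ CD * x $ CD + M $ i $ AC * x $ AC" for x i
    by (simp add: matrix_vector_mult_def UNIV_new_edge algebra_simps)
  have vecI: "x = y" if "x $ BC = y $ BC" "x $ CD = y $ CD" "x $ AC = y $ AC"
    for x y :: "real^new_edge"
    unfolding vec_eq_iff
  proof
    show "x $ i = y $ i" for i using that by (cases i) auto
  qed
  show "inj (\<lambda>t. t *\<^sub>R v)"
    using v0 by (simp add: inj_on_def)
  show "surj (\<lambda>y. v \<bullet> y)"
  proof (rule surjI)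
    show "v \<bullet> ((r / (v \<bullet> v)) *\<^sub>R v) = r" for r
      using v0 by simp
  qed
  show "range (\<lambda>t. t *\<^sub>R v) = {x. M *v x = 0}"
  proof (intro equalityI subsetI)
    fix x assume "x \<in> range (\<lambda>t. t *\<^sub>R v)"
    then show "x \<in> {x. M *v x = 0}"
      using ker by (auto simp: matrix_vector_mult_scaleR)
  next
    fix x assume "x \<in> {x. M *v x = 0}"
    define t where "t = x $ BC / v $ BC"
    define y where "y = x - t *\<^sub>R v"
    have "M *v y = 0"
      using \<open>x \<in> _\<close> ker by (simp add: y_def matrix_vector_mult_diff_distrib matrix_vector_mult_scaleR)
    moreover have yBC: "y $ BC = 0" using v by (simp add: y_def t_def)
    ultimately have "M $ CD $ CD * y $ CD + M $ CD $ AC * y $ AC = 0"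
      "M $ AC $ CD * y $ CD + M $ AC $ AC * y $ AC = 0"
      using ent[of y CD] ent[of y AC] by auto
    then have "m * y $ CD = 0" "m * y $ AC = 0"
      unfolding m(1) by algebra+
    then have "y = 0" using yBC m(2) by (intro vecI) auto
    then have "x = t *\<^sub>R v" by (simp add: y_def)
    then show "x \<in> range (\<lambda>t. t *\<^sub>R v)" by blast
  qed
  show "range (\<lambda>x. M *v x) = {y. v \<bullet> y = 0}"
  proof (intro equalityI subsetI)
    fix y assume "y \<in> {y. v \<bullet> y = 0}"
    define x :: "real^new_edge" where "x = (\<chi> e. case e of BC \<Rightarrow> 0
      | CD \<Rightarrow> (M $ AC $ AC * y $ CD - M $ CD $ AC * y $ AC) / m
      | AC \<Rightarrow> (M $ CD $ CD * y $ AC - M $ AC $ CD * y $ CD) / m)"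
    have x: "x $ BC = 0" "m * x $ CD = M $ AC $ AC * y $ CD - M $ CD $ AC * y $ AC"
      "m * x $ AC = M $ CD $ CD * y $ AC - M $ AC $ CD * y $ CD"
      using m(2) by (simp_all add: x_def)
    have "m * (M *v x) $ CD = m * y $ CD" "m * (M *v x) $ AC = m * y $ AC"
      using x m(1) unfolding ent by algebra+
    then have z: "(M *v x) $ CD = y $ CD" "(M *v x) $ AC = y $ AC"
      using m(2) by auto
    have "v \<bullet> (M *v x - y) = 0"
      using \<open>y \<in> _\<close> dot by (simp add: inner_diff_right)
    then have "v $ BC * ((M *v x) $ BC - y $ BC) = 0"
      using z by (simp add: inner_vec_def UNIV_new_edge)
    then have "M *v x = y"
      using v z by (intro vecI) auto
    then show "y \<in> range (\<lambda>x. M *v x)" by auto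
  qed (auto simp: dot)
qed

section \<open>Dihedral angles of isosceles tetrahedra as functions of lengths\<close>

text \<open>
The inner product of two sides of a triangle, by the law of cosines.
\<close>

definition dot_of_lengths :: "real \<Rightarrow> real \<Rightarrow> real \<Rightarrow> real" where
  "dot_of_lengths a b c = (a\<^sup>2 + b\<^sup>2 - c\<^sup>2) / 2"

lemma inner_eq_dot_of_lengths:
  fixes P Q R :: "'a::real_inner"
  shows "(Q - P) \<bullet> (R - P) = dot_of_lengths (dist P Q) (dist P R) (dist Q R)"
  by (simp add: dot_of_lengths_def dist_norm power2_norm_eq_inner inner_diff_left inner_diff_right
      inner_commute)

lemma dihedral_angle_eq_lengths:
  "dihedral_angle P Q R S = arccos
     (((dist P Q)\<^sup>2 * dot_of_lengths (dist P R) (dist P S) (dist R S)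
        - dot_of_lengths (dist P Q) (dist P R) (dist Q R) * dot_of_lengths (dist P Q) (dist P S) (dist Q S))
      / (sqrt ((dist P Q)\<^sup>2 * (dist P R)\<^sup>2 - (dot_of_lengths (dist P Q) (dist P R) (dist Q R))\<^sup>2)
         * sqrt ((dist P Q)\<^sup>2 * (dist P S)\<^sup>2 - (dot_of_lengths (dist P Q) (dist P S) (dist Q S))\<^sup>2)))"
proof -
  have lagrange: "cross3 x y \<bullet> cross3 x z = (x \<bullet> x) * (y \<bullet> z) - (x \<bullet> y) * (x \<bullet> z)"
    for x y z :: "real^3"
    by (simp add: cross3_simps)
  have norm: "norm (cross3 x y) = sqrt ((norm x)\<^sup>2 * (norm y)\<^sup>2 - (x \<bullet> y)\<^sup>2)" for x y :: "real^3"
    using lagrange[of x y y]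
    by (simp add: norm_eq_sqrt_inner power2_eq_square inner_commute)
  show ?thesis
    by (simp add: dihedral_angle_def Let_def lagrange norm flip: power2_norm_eq_inner)
       (simp add: inner_eq_dot_of_lengths dist_norm norm_minus_commute)
qed

text \<open>
  The definite description is legitimate because, by Lagrange's identity for cross products, the
  dihedral angle is a function of the six distances.  Consequently the angle function can be
  evaluated wherever a tetrahedron with the given lengths is exhibited.
\<close>

lemma dihedral_of_lengths_realized:
  "dihedral_of_lengths (dist P Q) (dist P R) (dist P S) (dist Q R) (dist Q S) (dist R S)
     = dihedral_angle P Q R S"
  unfolding dihedral_of_lengths_def
  by (rule the_equality) (auto simp: dihedral_angle_eq_lengths)

text \<open>
  In a triangle with base \<open>u\<close> and sides \<open>p\<close>, \<open>q\<close> at its two ends, the signed distance from the end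
  of \<open>p\<close> to the foot of the altitude, and the squared altitude.
\<close>

definition apex_proj :: "real \<Rightarrow> real \<Rightarrow> real \<Rightarrow> real" where
  "apex_proj u p q = (u\<^sup>2 + p\<^sup>2 - q\<^sup>2) / (2 * u)"

definition apex_height_sq :: "real \<Rightarrow> real \<Rightarrow> real \<Rightarrow> real" where
  "apex_height_sq u p q = p\<^sup>2 - (apex_proj u p q)\<^sup>2"

lemma apex_proj_swap: "u \<noteq> 0 \<Longrightarrow> apex_proj u q p = u - apex_proj u p q"
  by (simp add: apex_proj_def field_simps power2_eq_square)

lemma apex_height_sq_swap: "u \<noteq> 0 \<Longrightarrow> apex_height_sq u q p = apex_height_sq u p q"
  by (simp add: apex_height_sq_def apex_proj_def field_simps power2_eq_square)

lemma apex_height_sq_imp_pos: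
  assumes "0 < s" "s\<^sup>2 < 4 * apex_height_sq u p q"
  shows "0 < apex_height_sq u p q"
  using assms(2) zero_less_power[OF assms(1), of 2] by linarith

lemma dist_sq_3: "(dist P Q)\<^sup>2 = (P $ 1 - Q $ 1)\<^sup>2 + (P $ 2 - Q $ 2)\<^sup>2 + (P $ 3 - Q $ 3)\<^sup>2"
  for P Q :: "real^3"
  unfolding dist_norm power2_norm_eq_inner
  by (simp add: inner_vec_def sum_3 power2_eq_square)

text \<open>
  The altitude \<open>sqrt h\<close> to the base must be at least \<open>s / 2\<close>, for the apexes lie on a circle of that
  radius and are \<open>s\<close> apart.  The strict form of this condition is open in the lengths, so the
  closed forms below hold in neighbourhoods, as needed for differentiation.
\<close>

lemma isosceles_tetrahedron_exists:
  assumes "0 < u" "0 \<le> p" "0 \<le> q" "0 \<le> s" and s: "s\<^sup>2 \<le> 4 * apex_height_sq u p q"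
  obtains X Y Z W :: "real^3" where
    "dist X Y = u" "dist X Z = p" "dist X W = p" "dist Y Z = q" "dist Y W = q" "dist Z W = s"
proof -
  define w where "w = apex_proj u p q"
  define t where "t = sqrt (apex_height_sq u p q - s\<^sup>2 / 4)"
  have t: "t\<^sup>2 = p\<^sup>2 - w\<^sup>2 - s\<^sup>2 / 4"
    using s by (simp add: t_def w_def apex_height_sq_def)
  have w: "2 * u * w = u\<^sup>2 + p\<^sup>2 - q\<^sup>2"
    using \<open>0 < u\<close> by (simp add: w_def apex_proj_def)
  have eqI: "dist P Q = l" if "0 \<le> l" "(dist P Q)\<^sup>2 = l\<^sup>2" for P Q :: "real^3" and l
    using that by (simp add: power2_eq_iff_nonneg)
  define X Y Z W :: "real^3" where "X = vector [0, 0, 0]" and "Y = vector [0, 0, u]"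
    and "Z = vector [s/2, t, w]" and "W = vector [- s/2, t, w]"
  note defs = X_def Y_def Z_def W_def
  show thesis
  proof (rule that)
    show "dist X Y = u" "dist Z W = s"
      using assms by (auto intro!: eqI simp: dist_sq_3 defs power_divide)
    show "dist X Z = p" "dist X W = p"
      using assms t by (auto intro!: eqI simp: dist_sq_3 defs power_divide)
    show "dist Y Z = q" "dist Y W = q"
      using assms t w by (auto intro!: eqI simp: dist_sq_3 defs power_divide power2_diff)
  qed
qed

lemma dihedral_axis_closed_form:
  assumes "0 < u" "0 \<le> p" "0 \<le> q" "0 < s" and s: "s\<^sup>2 < 4 * apex_height_sq u p q"
  shows "dihedral_of_lengths u p p q q s = arccos (1 - s\<^sup>2 / (2 * apex_height_sq u p q))"
proof -
  define w h where "w = apex_proj u p q" and "h = apex_height_sq u p q"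
  have h: "0 < h" "h = p\<^sup>2 - w\<^sup>2"
    using apex_height_sq_imp_pos[OF \<open>0 < s\<close> s] by (simp_all add: h_def w_def apex_height_sq_def)
  obtain X Y Z W :: "real^3" where d:
    "dist X Y = u" "dist X Z = p" "dist X W = p" "dist Y Z = q" "dist Y W = q" "dist Z W = s"
    by (rule isosceles_tetrahedron_exists[OF assms(1-3) less_imp_le[OF assms(4)] less_imp_le[OF s]])
  have dots: "dot_of_lengths u p q = u * w" "dot_of_lengths p p s = p\<^sup>2 - s\<^sup>2 / 2"
    using \<open>0 < u\<close> by (simp_all add: dot_of_lengths_def w_def apex_proj_def field_simps)
  have "u\<^sup>2 * p\<^sup>2 - (u * w)\<^sup>2 = u\<^sup>2 * h" by (simp add: h algebra_simps)
  then have "dihedral_of_lengths u p p q q s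
      = arccos ((u\<^sup>2 * (p\<^sup>2 - s\<^sup>2 / 2) - u * w * (u * w)) / (u\<^sup>2 * h))"
    using dihedral_of_lengths_realized[of X Y Z W] dihedral_angle_eq_lengths[of X Y Z W] h(1)
    by (simp add: d dots)
  also have "u\<^sup>2 * (p\<^sup>2 - s\<^sup>2 / 2) - u * w * (u * w) = u\<^sup>2 * (h - s\<^sup>2 / 2)"
    by (simp add: h algebra_simps power2_eq_square)
  also have "u\<^sup>2 * (h - s\<^sup>2 / 2) / (u\<^sup>2 * h) = 1 - s\<^sup>2 / (2 * h)"
    using h(1) \<open>0 < u\<close> by (simp add: field_simps)
  finally show ?thesis by (simp add: h_def)
qed

lemma dihedral_side_closed_form:
  assumes "0 < u" "0 \<le> p" "0 \<le> q" "0 < s" and s: "s\<^sup>2 < 4 * apex_height_sq u q p"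
  shows "dihedral_of_lengths q q u s p p
    = arccos (s / sqrt (4 * q\<^sup>2 - s\<^sup>2) * (apex_proj u q p / sqrt (apex_height_sq u q p)))"
proof -
  define w h where "w = apex_proj u q p" and "h = apex_height_sq u q p"
  have h: "0 < h" "h = q\<^sup>2 - w\<^sup>2"
    using apex_height_sq_imp_pos[OF \<open>0 < s\<close> s] by (simp_all add: h_def w_def apex_height_sq_def)
  have T: "0 < 4 * q\<^sup>2 - s\<^sup>2"
    using s h(2) zero_le_power2[of w] unfolding h_def[symmetric] by linarith
  obtain Y X Z W :: "real^3" where d:
    "dist Y X = u" "dist Y Z = q" "dist Y W = q" "dist X Z = p" "dist X W = p" "dist Z W = s"
    by (rule isosceles_tetrahedron_exists[OF assms(1) assms(3) assms(2) less_imp_le[OF assms(4)] less_imp_le[OF s]])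
  have d': "dist Z X = p" "dist W X = p" using d by (simp_all add: dist_commute)
  have dots: "dot_of_lengths q u p = u * w" "dot_of_lengths q q s = q\<^sup>2 - s\<^sup>2 / 2"
    using \<open>0 < u\<close> by (simp_all add: dot_of_lengths_def w_def apex_proj_def field_simps)
  have "q\<^sup>2 * q\<^sup>2 - (q\<^sup>2 - s\<^sup>2 / 2)\<^sup>2 = (s / 2)\<^sup>2 * (4 * q\<^sup>2 - s\<^sup>2)"
    by (simp add: field_simps power2_eq_square)
  moreover have "q\<^sup>2 * u\<^sup>2 - (u * w)\<^sup>2 = u\<^sup>2 * h" by (simp add: h algebra_simps)
  ultimately have "dihedral_of_lengths q q u s p p
      = arccos ((q\<^sup>2 * (u * w) - (q\<^sup>2 - s\<^sup>2 / 2) * (u * w))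
          / ((s / 2 * sqrt (4 * q\<^sup>2 - s\<^sup>2)) * (u * sqrt h)))"
    using dihedral_of_lengths_realized[of Y Z W X] dihedral_angle_eq_lengths[of Y Z W X] assms(1,4)
    by (simp add: d d' dots real_sqrt_mult)
  also have "q\<^sup>2 * (u * w) - (q\<^sup>2 - s\<^sup>2 / 2) * (u * w) = s\<^sup>2 / 2 * (u * w)"
    by (simp add: algebra_simps)
  also have "s\<^sup>2 / 2 * (u * w) / ((s / 2 * sqrt (4 * q\<^sup>2 - s\<^sup>2)) * (u * sqrt h))
      = s / sqrt (4 * q\<^sup>2 - s\<^sup>2) * (w / sqrt h)"
    using h(1) T assms(1,4) by (simp add: field_simps power2_eq_square)
  finally show ?thesis by (simp add: h_def w_def)
qed

lemma dihedral_axis_swap: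
  assumes "0 < u" "0 \<le> p" "0 \<le> q" "0 < s" "s\<^sup>2 < 4 * apex_height_sq u p q"
  shows "dihedral_of_lengths u q q p p s = dihedral_of_lengths u p p q q s"
  using assms apex_height_sq_swap[of u q p] by (simp add: dihedral_axis_closed_form)

section \<open>Derivatives of the dihedral angles\<close>

lemma eventually_nhds_gt_of_DERIV:
  fixes f :: "real \<Rightarrow> real"
  assumes "(f has_real_derivative D) (at x)" "c < f x"
  shows "\<forall>\<^sub>F y in nhds x. c < f y"
proof -
  have "(f \<longlongrightarrow> f x) (nhds x)"
    using DERIV_isCont[OF assms(1)] by (simp add: isCont_def tendsto_at_iff_tendsto_nhds)
  then show ?thesis using assms(2) by (rule order_tendstoD)
qed

lemma DERIV_apex_proj_base:
  assumes "u \<noteq> 0"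
  shows "((\<lambda>x. apex_proj x p q) has_real_derivative (u - apex_proj u p q) / u) (at u)"
  unfolding apex_proj_def using assms
  by (auto intro!: derivative_eq_intros simp: field_simps power2_eq_square)

lemma DERIV_apex_proj_near:
  assumes "u \<noteq> 0"
  shows "((\<lambda>x. apex_proj u x p) has_real_derivative q / u) (at q)"
  unfolding apex_proj_def using assms
  by (auto intro!: derivative_eq_intros simp: field_simps power2_eq_square)

lemma DERIV_apex_height_sq_base:
  assumes "u \<noteq> 0"
  shows "((\<lambda>x. apex_height_sq x p q) has_real_derivative
           - 2 * apex_proj u p q * (u - apex_proj u p q) / u) (at u)"
  unfolding apex_height_sq_def using assms
  by (auto intro!: derivative_eq_intros DERIV_apex_proj_base)

lemma DERIV_apex_height_sq_near:
  assumes "u \<noteq> 0"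
  shows "((\<lambda>x. apex_height_sq u x p) has_real_derivative 2 * q * (u - apex_proj u q p) / u) (at q)"
  unfolding apex_height_sq_def using assms
  by (auto intro!: derivative_eq_intros DERIV_apex_proj_near simp: field_simps)

lemma DERIV_arccos_height:
  fixes h s :: real
  assumes "0 < s" "s\<^sup>2 < 4 * h"
  shows "((\<lambda>h. arccos (1 - s\<^sup>2 / (2 * h))) has_real_derivative - (s / (h * sqrt (4 * h - s\<^sup>2)))) (at h)"
proof -
  define r where "r = sqrt (4 * h - s\<^sup>2)"
  have h: "0 < h" using assms zero_less_power[of s 2] by linarith
  have r: "0 < r" "r\<^sup>2 = 4 * h - s\<^sup>2" using assms by (simp_all add: r_def)
  have "1 - (1 - s\<^sup>2 / (2 * h))\<^sup>2 = (s * r / (2 * h))\<^sup>2"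
    unfolding power_mult_distrib power_divide r
    using h by (simp add: field_simps power2_eq_square)
  then have root: "sqrt (1 - (1 - s\<^sup>2 / (2 * h))\<^sup>2) = s * r / (2 * h)"
    using h r assms by simp
  have "s\<^sup>2 / (2 * h) < 2" "0 < s\<^sup>2 / (2 * h)"
    using h assms by (simp_all add: field_simps)
  then have "(arccos has_real_derivative inverse (- sqrt (1 - (1 - s\<^sup>2 / (2 * h))\<^sup>2)))
      (at (1 - s\<^sup>2 / (2 * h)))"
    by (intro DERIV_arccos) auto
  moreover have "((\<lambda>h. 1 - s\<^sup>2 / (2 * h)) has_real_derivative s\<^sup>2 / (2 * h\<^sup>2)) (at h)"
    using h by (auto intro!: derivative_eq_intros simp: field_simps power2_eq_square)
  ultimately have "((\<lambda>h. arccos (1 - s\<^sup>2 / (2 * h))) has_real_derivative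
      inverse (- sqrt (1 - (1 - s\<^sup>2 / (2 * h))\<^sup>2)) * (s\<^sup>2 / (2 * h\<^sup>2))) (at h)"
    by (rule DERIV_chain2)
  also have "inverse (- sqrt (1 - (1 - s\<^sup>2 / (2 * h))\<^sup>2)) * (s\<^sup>2 / (2 * h\<^sup>2)) = - (s / (h * r))"
    unfolding root using h r assms by (simp add: field_simps power2_eq_square)
  finally show ?thesis by (simp add: r_def)
qed


lemma DERIV_dihedral_axis_base:
  assumes pos: "0 < u" "0 \<le> p" "0 \<le> q" "0 < s" and s: "s\<^sup>2 < 4 * apex_height_sq u p q"
  defines "h \<equiv> apex_height_sq u p q" and "w \<equiv> apex_proj u p q"
  shows "((\<lambda>x. dihedral_of_lengths x p p q q s) has_real_derivative
    2 * (s / (h * sqrt (4 * h - s\<^sup>2))) * (w * (u - w) / u)) (at u)"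
proof -
  have D: "((\<lambda>x. apex_height_sq x p q) has_real_derivative - 2 * w * (u - w) / u) (at u)"
    unfolding w_def using pos by (intro DERIV_apex_height_sq_base) auto
  have "\<forall>\<^sub>F x in nhds u. s\<^sup>2 < 4 * apex_height_sq x p q" "\<forall>\<^sub>F x in nhds u. 0 < x"
    using eventually_nhds_gt_of_DERIV[OF DERIV_cmult[OF D] s]
      eventually_nhds_gt_of_DERIV[OF DERIV_ident, of 0 u] pos by simp_all
  then have ev: "\<forall>\<^sub>F x in nhds u. dihedral_of_lengths x p p q q s
      = arccos (1 - s\<^sup>2 / (2 * apex_height_sq x p q))"
    by eventually_elim (use pos in \<open>auto intro!: dihedral_axis_closed_form\<close>)
  have "((\<lambda>x. arccos (1 - s\<^sup>2 / (2 * apex_height_sq x p q))) has_real_derivative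
      - (s / (h * sqrt (4 * h - s\<^sup>2))) * (- 2 * w * (u - w) / u)) (at u)"
    unfolding h_def by (rule DERIV_chain2[OF DERIV_arccos_height D]) (use pos s in auto)
  then show ?thesis
    unfolding DERIV_cong_ev[OF refl ev refl] by (simp add: mult_ac)
qed

lemma DERIV_dihedral_axis_near:
  assumes pos: "0 < u" "0 < q" "0 \<le> p" "0 < s" and s: "s\<^sup>2 < 4 * apex_height_sq u q p"
  defines "h \<equiv> apex_height_sq u q p" and "w \<equiv> apex_proj u q p"
  defines "d \<equiv> - 2 * (s / (h * sqrt (4 * h - s\<^sup>2))) * (q * (u - w) / u)"
  shows "((\<lambda>x. dihedral_of_lengths u x x p p s) has_real_derivative d) (at q)"
    and "((\<lambda>x. dihedral_of_lengths u p p x x s) has_real_derivative d) (at q)"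
proof -
  have D: "((\<lambda>x. apex_height_sq u x p) has_real_derivative 2 * q * (u - w) / u) (at q)"
    unfolding w_def using pos by (intro DERIV_apex_height_sq_near) auto
  have e: "\<forall>\<^sub>F x in nhds q. s\<^sup>2 < 4 * apex_height_sq u x p" "\<forall>\<^sub>F x in nhds q. 0 < x"
    using eventually_nhds_gt_of_DERIV[OF DERIV_cmult[OF D] s]
      eventually_nhds_gt_of_DERIV[OF DERIV_ident, of 0 q] pos by simp_all
  then have ev: "\<forall>\<^sub>F x in nhds q. dihedral_of_lengths u x x p p s
      = arccos (1 - s\<^sup>2 / (2 * apex_height_sq u x p))"
    by eventually_elim (use pos in \<open>auto intro!: dihedral_axis_closed_form\<close>)
  have "((\<lambda>x. arccos (1 - s\<^sup>2 / (2 * apex_height_sq u x p))) has_real_derivative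
      - (s / (h * sqrt (4 * h - s\<^sup>2))) * (2 * q * (u - w) / u)) (at q)"
    unfolding h_def by (rule DERIV_chain2[OF DERIV_arccos_height D]) (use pos s in auto)
  then show d1: "((\<lambda>x. dihedral_of_lengths u x x p p s) has_real_derivative d) (at q)"
    unfolding DERIV_cong_ev[OF refl ev refl] d_def by (simp add: mult_ac)
  have "\<forall>\<^sub>F x in nhds q. dihedral_of_lengths u p p x x s = dihedral_of_lengths u x x p p s"
    using e by eventually_elim (use pos in \<open>auto intro!: dihedral_axis_swap\<close>)
  then show "((\<lambda>x. dihedral_of_lengths u p p x x s) has_real_derivative d) (at q)"
    using d1 by (simp add: DERIV_cong_ev)
qed

text \<open>
  One computation for both derivatives of the angle at a side: \<open>w\<close> is the projection, \<open>h\<close> the squared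
  altitude and \<open>t\<close> the quantity \<open>4 q\<^sup>2 - s\<^sup>2\<close>, any of which may vary.  The radical
  simplifies because \<open>t h - s\<^sup>2 w\<^sup>2 = q\<^sup>2 (4 h - s\<^sup>2)\<close> when \<open>q\<^sup>2 = h + w\<^sup>2\<close>.
\<close>

lemma DERIV_arccos_side:
  fixes w h t :: "real \<Rightarrow> real" and q s :: real
  assumes D: "(w has_real_derivative w') (at x)" "(h has_real_derivative h') (at x)"
      "(t has_real_derivative t') (at x)"
    and pos: "0 < s" "0 < q" "s\<^sup>2 < 4 * h x"
    and q: "q\<^sup>2 = h x + (w x)\<^sup>2" and t: "t x = 4 * q\<^sup>2 - s\<^sup>2"
  shows "((\<lambda>y. arccos (s / sqrt (t y) * (w y / sqrt (h y)))) has_real_derivative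
    - (s / (q * sqrt (4 * h x - s\<^sup>2))) * (w' - w x * h' / (2 * h x) - w x * t' / (2 * t x))) (at x)"
proof -
  define r T k E where "r = sqrt (4 * h x - s\<^sup>2)" and "T = sqrt (t x)" and "k = sqrt (h x)"
    and "E = s / T * (w x / k)"
  have hpos: "0 < h x" using pos(3) zero_less_power[OF pos(1), of 2] by linarith
  have tpos: "0 < t x" using pos(3) q t zero_le_power2[of "w x"] by linarith
  have r: "0 < r" "r\<^sup>2 = 4 * h x - s\<^sup>2" using pos by (simp_all add: r_def)
  have T: "0 < T" "T\<^sup>2 = t x" using tpos by (simp_all add: T_def)
  have k: "0 < k" "k\<^sup>2 = h x" using hpos by (simp_all add: k_def)
  have tk: "T\<^sup>2 * k\<^sup>2 - s\<^sup>2 * (w x)\<^sup>2 = q\<^sup>2 * r\<^sup>2"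
    unfolding T k r t q by (simp add: algebra_simps power2_eq_square)
  have "1 - E\<^sup>2 = (T\<^sup>2 * k\<^sup>2 - s\<^sup>2 * (w x)\<^sup>2) / (T\<^sup>2 * k\<^sup>2)"
    using T(1) k(1) by (simp add: E_def power_mult_distrib power_divide field_simps)
  also have "\<dots> = (q * r / (T * k))\<^sup>2"
    unfolding tk by (simp add: power_mult_distrib power_divide)
  finally have E: "1 - E\<^sup>2 = (q * r / (T * k))\<^sup>2" .
  then have root: "sqrt (1 - E\<^sup>2) = q * r / (T * k)"
    using pos r T k by simp
  have "0 < (q * r / (T * k))\<^sup>2" using pos r T k by simp
  then have "E\<^sup>2 < 1" using E by linarith
  then have "\<bar>E\<bar> < 1" by (simp add: abs_square_less_1)
  then have A: "(arccos has_real_derivative inverse (- sqrt (1 - E\<^sup>2))) (at E)"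
    by (intro DERIV_arccos) auto
  have "((\<lambda>y. s / sqrt (t y) * (w y / sqrt (h y))) has_real_derivative
      s / (T * k) * (w' - w x * h' / (2 * h x) - w x * t' / (2 * t x))) (at x)"
    apply (rule derivative_eq_intros D refl hpos tpos | (use hpos tpos in simp; fail))+
    unfolding T_def[symmetric] k_def[symmetric] T(2)[symmetric] k(2)[symmetric]
    using T(1) k(1) by (simp add: field_simps power2_eq_square)
  from DERIV_chain2[OF A[unfolded E_def T_def k_def] this]
  have "((\<lambda>y. arccos (s / sqrt (t y) * (w y / sqrt (h y)))) has_real_derivative
      inverse (- sqrt (1 - E\<^sup>2)) * (s / (T * k) * (w' - w x * h' / (2 * h x) - w x * t' / (2 * t x)))) (at x)"
    unfolding E_def T_def k_def .
  moreover have "inverse (- sqrt (1 - E\<^sup>2)) * (s / (T * k) * z) = - (s / (q * r)) * z" for z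
    unfolding root using T(1) k(1) r(1) pos by (simp add: field_simps)
  ultimately show ?thesis by (simp add: r_def)
qed

lemma DERIV_dihedral_side_base:
  assumes pos: "0 < u" "0 \<le> p" "0 < q" "0 < s" and s: "s\<^sup>2 < 4 * apex_height_sq u q p"
  defines "h \<equiv> apex_height_sq u q p" and "w \<equiv> apex_proj u q p"
  shows "((\<lambda>x. dihedral_of_lengths q q x s p p) has_real_derivative
    - (s / (h * sqrt (4 * h - s\<^sup>2))) * (q * (u - w) / u)) (at u)"
proof -
  have D: "((\<lambda>x. apex_proj x q p) has_real_derivative (u - w) / u) (at u)"
     "((\<lambda>x. apex_height_sq x q p) has_real_derivative - 2 * w * (u - w) / u) (at u)"
    unfolding w_def using pos using DERIV_apex_proj_base[of u q p] DERIV_apex_height_sq_base[of u q p] by simp_all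
  have "\<forall>\<^sub>F x in nhds u. s\<^sup>2 < 4 * apex_height_sq x q p" "\<forall>\<^sub>F x in nhds u. 0 < x"
    using eventually_nhds_gt_of_DERIV[OF DERIV_cmult[OF D(2)] s]
      eventually_nhds_gt_of_DERIV[OF DERIV_ident, of 0 u] pos by simp_all
  then have ev: "\<forall>\<^sub>F x in nhds u. dihedral_of_lengths q q x s p p
      = arccos (s / sqrt (4 * q\<^sup>2 - s\<^sup>2) * (apex_proj x q p / sqrt (apex_height_sq x q p)))"
    by eventually_elim (rule dihedral_side_closed_form, use pos in auto)
  have h: "0 < h" using s pos apex_height_sq_imp_pos unfolding h_def by blast
  have q: "q\<^sup>2 = h + w\<^sup>2" by (simp add: h_def w_def apex_height_sq_def)
  have "((\<lambda>x. arccos (s / sqrt (4 * q\<^sup>2 - s\<^sup>2) * (apex_proj x q p / sqrt (apex_height_sq x q p))))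
      has_real_derivative - (s / (q * sqrt (4 * h - s\<^sup>2)))
        * ((u - w) / u - w * (- 2 * w * (u - w) / u) / (2 * h) - w * 0 / (2 * (4 * q\<^sup>2 - s\<^sup>2)))) (at u)"
    unfolding h_def w_def
    by (rule DERIV_arccos_side[OF D[unfolded w_def] DERIV_const])
       (use pos s in \<open>auto simp: apex_height_sq_def\<close>)
  also have "(u - w) / u - w * (- 2 * w * (u - w) / u) / (2 * h) - w * 0 / (2 * (4 * q\<^sup>2 - s\<^sup>2))
      = q\<^sup>2 / h * ((u - w) / u)"
    unfolding q using h pos by (simp add: field_simps power2_eq_square)
  also have "- (s / (q * sqrt (4 * h - s\<^sup>2))) * (q\<^sup>2 / h * ((u - w) / u))
      = - (s / (h * sqrt (4 * h - s\<^sup>2))) * (q * (u - w) / u)"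
    using pos by (simp add: power2_eq_square)
  finally show ?thesis
    unfolding DERIV_cong_ev[OF refl ev refl] .
qed

lemma DERIV_dihedral_side_near:
  assumes pos: "0 < u" "0 \<le> p" "0 < q" "0 < s" and s: "s\<^sup>2 < 4 * apex_height_sq u q p"
  defines "h \<equiv> apex_height_sq u q p" and "w \<equiv> apex_proj u q p"
  shows "((\<lambda>x. dihedral_of_lengths x x u s p p) has_real_derivative
    - (s / (h * sqrt (4 * h - s\<^sup>2))) * (q\<^sup>2 / u - w * (1 + 4 * h / (4 * q\<^sup>2 - s\<^sup>2)))) (at q)"
proof -
  have D: "((\<lambda>x. apex_proj u x p) has_real_derivative q / u) (at q)"
     "((\<lambda>x. apex_height_sq u x p) has_real_derivative 2 * q * (u - w) / u) (at q)"
    unfolding w_def using pos using DERIV_apex_proj_near[of u p q] DERIV_apex_height_sq_near[of u p q] by simp_all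
  have T: "((\<lambda>x. 4 * x\<^sup>2 - s\<^sup>2) has_real_derivative 8 * q) (at q)"
    by (auto intro!: derivative_eq_intros)
  have "\<forall>\<^sub>F x in nhds q. s\<^sup>2 < 4 * apex_height_sq u x p" "\<forall>\<^sub>F x in nhds q. 0 < x"
    using eventually_nhds_gt_of_DERIV[OF DERIV_cmult[OF D(2)] s]
      eventually_nhds_gt_of_DERIV[OF DERIV_ident, of 0 q] pos by simp_all
  then have ev: "\<forall>\<^sub>F x in nhds q. dihedral_of_lengths x x u s p p
      = arccos (s / sqrt (4 * x\<^sup>2 - s\<^sup>2) * (apex_proj u x p / sqrt (apex_height_sq u x p)))"
    by eventually_elim (rule dihedral_side_closed_form, use pos in auto)
  have h: "0 < h" using s pos apex_height_sq_imp_pos unfolding h_def by blast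
  have q: "q\<^sup>2 = h + w\<^sup>2" by (simp add: h_def w_def apex_height_sq_def)
  have t: "0 < 4 * q\<^sup>2 - s\<^sup>2"
    using s q zero_le_power2[of w] unfolding h_def[symmetric] by linarith
  define t where "t = 4 * q\<^sup>2 - s\<^sup>2"
  have "((\<lambda>x. arccos (s / sqrt (4 * x\<^sup>2 - s\<^sup>2) * (apex_proj u x p / sqrt (apex_height_sq u x p))))
      has_real_derivative - (s / (q * sqrt (4 * h - s\<^sup>2)))
        * (q / u - w * (2 * q * (u - w) / u) / (2 * h) - w * (8 * q) / (2 * t))) (at q)"
    unfolding h_def w_def t_def
    by (rule DERIV_arccos_side[OF D[unfolded w_def] T])
       (use pos s in \<open>auto simp: apex_height_sq_def\<close>)
  also have "q / u - w * (2 * q * (u - w) / u) / (2 * h) - w * (8 * q) / (2 * t)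
      = q / h * ((h + w\<^sup>2) / u - w * (1 + 4 * h / t))"
    using h pos t unfolding t_def[symmetric] by (simp add: field_simps power2_eq_square)
  also have "- (s / (q * sqrt (4 * h - s\<^sup>2))) * (q / h * ((h + w\<^sup>2) / u - w * (1 + 4 * h / t)))
      = - (s / (h * sqrt (4 * h - s\<^sup>2))) * (q\<^sup>2 / u - w * (1 + 4 * h / t))"
    unfolding q using pos by simp
  finally show ?thesis
    unfolding DERIV_cong_ev[OF refl ev refl] t_def .
qed

section \<open>Tetrahedra over the axis\<close>

definition axis_dist_sq :: "real^3 \<Rightarrow> real" where
  "axis_dist_sq A = (A $ 1)\<^sup>2 + (A $ 2)\<^sup>2"

lemma dist_axis_point_sq:
  "X \<in> z_axis \<Longrightarrow> (dist A X)\<^sup>2 = axis_dist_sq A + (A $ 3 - X $ 3)\<^sup>2"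
  by (simp add: dist_sq_3 axis_dist_sq_def z_axis_def)

lemma dist_axis_points:
  assumes "X \<in> z_axis" "Y \<in> z_axis"
  shows "dist X Y = \<bar>X $ 3 - Y $ 3\<bar>"
  using assms by (simp add: power2_eq_iff_nonneg[symmetric] dist_sq_3 z_axis_def)

lemma apex_over_axis:
  assumes "X \<in> z_axis" "Y \<in> z_axis" "X $ 3 \<noteq> Y $ 3"
  shows "apex_proj (dist X Y) (dist A X) (dist A Y) = sgn (X $ 3 - Y $ 3) * (X $ 3 - A $ 3)"
    and "apex_height_sq (dist X Y) (dist A X) (dist A Y) = axis_dist_sq A"
proof -
  define e where "e = sgn (X $ 3 - Y $ 3)"
  have e: "e * e = 1" "\<bar>X $ 3 - Y $ 3\<bar> = e * (X $ 3 - Y $ 3)"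
    using assms(3) by (auto simp: e_def sgn_if)
  have "(dist X Y)\<^sup>2 + (dist A X)\<^sup>2 - (dist A Y)\<^sup>2 = 2 * (X $ 3 - Y $ 3) * (X $ 3 - A $ 3)"
    unfolding dist_axis_point_sq[OF assms(1)] dist_axis_point_sq[OF assms(2)]
      dist_axis_points[OF assms(1,2)] power2_abs
    by (simp add: algebra_simps power2_eq_square)
  also have "\<dots> = 2 * dist X Y * (e * (X $ 3 - A $ 3))"
    unfolding dist_axis_points[OF assms(1,2)] e(2) using e(1) by algebra
  finally show proj: "apex_proj (dist X Y) (dist A X) (dist A Y) = e * (X $ 3 - A $ 3)"
    using assms(3) by (auto simp: apex_proj_def)
  show "apex_height_sq (dist X Y) (dist A X) (dist A Y) = axis_dist_sq A"
    unfolding apex_height_sq_def proj dist_axis_point_sq[OF assms(1)] power_mult_distrib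
    using e(1) by (simp add: power2_commute flip: power2_eq_square)
qed

text \<open>
  The sign \<open>e\<close> of \<open>x - y\<close> turns the length \<open>u\<close> and both projections into signed height
  differences.  The second, third and fourth derivatives agree up to the factor two; this is the
  source of the symmetry of the matrix, since the edge \<open>AC\<close> collects its angles twice.
\<close>

lemma DERIV_dihedral_over_axis:
  fixes A X Y :: "real^3" and s :: real
  assumes axis: "X \<in> z_axis" "Y \<in> z_axis" "X $ 3 \<noteq> Y $ 3"
    and s: "0 < s" "s\<^sup>2 < 4 * axis_dist_sq A"
  defines "x \<equiv> X $ 3" and "y \<equiv> Y $ 3" and "a \<equiv> A $ 3"
    and "u \<equiv> dist X Y" and "p \<equiv> dist A X" and "q \<equiv> dist A Y" and "h \<equiv> axis_dist_sq A"
  defines "e \<equiv> sgn (x - y)" and "g \<equiv> s / (h * sqrt (4 * h - s\<^sup>2))"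
  shows "((\<lambda>t. dihedral_of_lengths t p p q q s) has_real_derivative
           2 * g * (e * (x - a) * (a - y) / (x - y))) (at u)"
    and "((\<lambda>t. dihedral_of_lengths u t t p p s) has_real_derivative
           - 2 * g * (q * (x - a) / (x - y))) (at q)"
    and "((\<lambda>t. dihedral_of_lengths u p p t t s) has_real_derivative
           - 2 * g * (q * (x - a) / (x - y))) (at q)"
    and "((\<lambda>t. dihedral_of_lengths q q t s p p) has_real_derivative
           - g * (q * (x - a) / (x - y))) (at u)"
    and "((\<lambda>t. dihedral_of_lengths t t u s p p) has_real_derivative
           - g * e * (q\<^sup>2 / (x - y) - (a - y) * (1 + 4 * h / (4 * q\<^sup>2 - s\<^sup>2)))) (at q)"
proof -
  have e: "e * e = 1" "u = e * (x - y)" "e \<noteq> 0" "x - y \<noteq> 0"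
    using axis by (auto simp: e_def sgn_if u_def dist_axis_points x_def y_def)
  have u: "0 < u" using axis by (auto simp: u_def)
  have proj: "apex_proj u p q = e * (x - a)"
    using apex_over_axis(1)[OF axis, of A] by (simp add: u_def p_def q_def e_def x_def y_def a_def)
  have height: "apex_height_sq u p q = h"
    using apex_over_axis(2)[OF axis, of A] by (simp add: u_def p_def q_def h_def)
  have height': "apex_height_sq u q p = h"
    using apex_height_sq_swap[of u q p] u height by simp
  have h: "0 < h" using s zero_less_power[OF s(1), of 2] unfolding h_def by linarith
  have "p\<^sup>2 = h + (a - x)\<^sup>2" "q\<^sup>2 = h + (a - y)\<^sup>2"
    unfolding p_def q_def h_def a_def x_def y_def using axis by (simp_all add: dist_axis_point_sq)
  then have "0 < p\<^sup>2" "0 < q\<^sup>2" using h by (simp_all add: add_pos_nonneg)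
  then have pq: "0 < p" "0 < q"
    by (auto simp: p_def q_def)
  have s': "s\<^sup>2 < 4 * apex_height_sq u p q" "s\<^sup>2 < 4 * apex_height_sq u q p"
    using s(2) by (simp_all add: height height' h_def)
  have diff: "u - e * (x - a) = e * (a - y)" "u - e * (a - y) = e * (x - a)"
    unfolding e(2) by (simp_all add: algebra_simps)
  have proj': "apex_proj u q p = e * (a - y)"
    using apex_proj_swap[of u q p] u unfolding proj diff by simp
  have quot: "e * z / u = z / (x - y)" for z
    unfolding e(2) using e(3) by simp
  have "e * (x - a) * (e * (a - y)) / u = e * (x - a) * (a - y) / (x - y)"
    using quot[of "(x - a) * (e * (a - y))"] by (simp add: mult_ac)
  then show "((\<lambda>t. dihedral_of_lengths t p p q q s) has_real_derivative
           2 * g * (e * (x - a) * (a - y) / (x - y))) (at u)"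
    using DERIV_dihedral_axis_base[OF u _ _ s(1) s'(1)] pq
    by (simp only: proj height diff g_def less_imp_le)
  have near: "q * (e * (x - a)) / u = q * (x - a) / (x - y)"
    using quot[of "q * (x - a)"] by (simp add: mult_ac)
  show "((\<lambda>t. dihedral_of_lengths u t t p p s) has_real_derivative
           - 2 * g * (q * (x - a) / (x - y))) (at q)"
    "((\<lambda>t. dihedral_of_lengths u p p t t s) has_real_derivative
           - 2 * g * (q * (x - a) / (x - y))) (at q)"
    using DERIV_dihedral_axis_near[OF u pq(2) less_imp_le[OF pq(1)] s(1) s'(2)]
    by (simp_all only: proj' height' diff g_def near)
  show "((\<lambda>t. dihedral_of_lengths q q t s p p) has_real_derivative
           - g * (q * (x - a) / (x - y))) (at u)"
    using DERIV_dihedral_side_base[OF u less_imp_le[OF pq(1)] pq(2) s(1) s'(2)]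
    by (simp only: proj' height' diff g_def near)
  have "q\<^sup>2 / u = e * (q\<^sup>2 / (x - y))"
    using quot[of "e * q\<^sup>2"] e(1) by (simp flip: mult.assoc)
  then have "q\<^sup>2 / u - e * (a - y) * (1 + 4 * h / (4 * q\<^sup>2 - s\<^sup>2))
     = e * (q\<^sup>2 / (x - y) - (a - y) * (1 + 4 * h / (4 * q\<^sup>2 - s\<^sup>2)))"
    by (simp add: right_diff_distrib mult.assoc)
  then show "((\<lambda>t. dihedral_of_lengths t t u s p p) has_real_derivative
           - g * e * (q\<^sup>2 / (x - y) - (a - y) * (1 + 4 * h / (4 * q\<^sup>2 - s\<^sup>2)))) (at q)"
    using DERIV_dihedral_side_near[OF u less_imp_le[OF pq(1)] pq(2) s(1) s'(2)]
    by (simp only: proj' height' g_def mult.assoc)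
qed

lemma oriented_volume_rotation_z:
  assumes "X \<in> z_axis" "Y \<in> z_axis"
  shows "6 * oriented_volume X A (rotation_z \<phi> A) Y = (Y $ 3 - X $ 3) * axis_dist_sq A * sin \<phi>"
  using assms
  by (simp add: oriented_volume_def)
     (simp add: z_axis_def rotation_z_def axis_dist_sq_def cross3_def
      inner_vec_def sum_3 algebra_simps power2_eq_square)

lemma dist_rotation_z_sq:
  "(dist A (rotation_z \<phi> A))\<^sup>2 = 2 * axis_dist_sq A * (1 - cos \<phi>)"
proof -
  have "(dist A (rotation_z \<phi> A))\<^sup>2
      = (A $ 1 - (cos \<phi> * A $ 1 - sin \<phi> * A $ 2))\<^sup>2 + (A $ 2 - (sin \<phi> * A $ 1 + cos \<phi> * A $ 2))\<^sup>2"
    by (simp add: dist_sq_3 rotation_z_def)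
  also have "\<dots> = 2 * axis_dist_sq A * (1 - cos \<phi>)"
    unfolding axis_dist_sq_def using sin_cos_squared_add[of \<phi>] by algebra
  finally show ?thesis .
qed

section \<open>The maps of the two complexes\<close>

text \<open>
  Here \<open>\<epsilon>\<close> is the common orientation sign: the volumes of the tetrahedra have the signs of
  \<open>\<epsilon> (b - d)\<close>, \<open>\<epsilon> (b - c)\<close> and \<open>\<epsilon> (c - d)\<close>.  The squared distance \<open>\<rho>\<close> of the apexes from the axis is
  the common value of the squared altitudes of all three, and \<open>g\<close> the common factor of the derivatives.
\<close>

locale axis_configuration =
  fixes \<phi> :: real and A1 A2 B C D :: "real^3"
  assumes axis: "B \<in> z_axis" "C \<in> z_axis" "D \<in> z_axis"
    and rot: "A2 = rotation_z \<phi> A1"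
    and vol_BDAA: "oriented_volume D A1 A2 B \<noteq> 0"
    and vol_BCAA: "oriented_volume C A1 A2 B \<noteq> 0"
    and vol_CDAA: "oriented_volume D A1 A2 C \<noteq> 0"
begin

definition "a = A1 $ 3"
definition "b = B $ 3"
definition "c = C $ 3"
definition "d = D $ 3"
definition "\<rho> = axis_dist_sq A1"
definition "\<epsilon> = sgn (sin \<phi>)"
definition "s = dist A1 A2"
definition "q = dist A1 C"

definition "g = s / (\<rho> * sqrt (4 * \<rho> - s\<^sup>2))"

lemma six_volumes:
  "6 * oriented_volume D A1 A2 B = (b - d) * \<rho> * sin \<phi>"
  "6 * oriented_volume C A1 A2 B = (b - c) * \<rho> * sin \<phi>"
  "6 * oriented_volume D A1 A2 C = (c - d) * \<rho> * sin \<phi>"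
  unfolding rot b_def c_def d_def \<rho>_def using axis by (simp_all only: oriented_volume_rotation_z)

lemma distinct_heights: "b \<noteq> d" "b \<noteq> c" "c \<noteq> d"
  and rho_pos: "0 < \<rho>" and sin_nz: "sin \<phi> \<noteq> 0"
proof -
  show "b \<noteq> d" "b \<noteq> c" "c \<noteq> d" "sin \<phi> \<noteq> 0"
    using vol_BDAA vol_BCAA vol_CDAA six_volumes by auto
  have "\<rho> \<noteq> 0" using vol_BDAA six_volumes by auto
  moreover have "0 \<le> \<rho>" by (simp add: \<rho>_def axis_dist_sq_def)
  ultimately show "0 < \<rho>" by linarith
qed

lemma sgn_volumes:
  "sgn (oriented_volume D A1 A2 B) = \<epsilon> * sgn (b - d)"
  "sgn (oriented_volume C A1 A2 B) = \<epsilon> * sgn (b - c)"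
  "sgn (oriented_volume D A1 A2 C) = \<epsilon> * sgn (c - d)"
proof -
  have "sgn v = \<epsilon> * sgn z" if "6 * v = z * \<rho> * sin \<phi>" for v z :: real
  proof -
    have "sgn v = sgn (6 * v)" by (simp add: sgn_mult)
    also have "\<dots> = sgn z * \<epsilon>" unfolding that using rho_pos by (simp add: sgn_mult \<epsilon>_def)
    finally show ?thesis by simp
  qed
  then show
    "sgn (oriented_volume D A1 A2 B) = \<epsilon> * sgn (b - d)"
    "sgn (oriented_volume C A1 A2 B) = \<epsilon> * sgn (b - c)"
    "sgn (oriented_volume D A1 A2 C) = \<epsilon> * sgn (c - d)"
    using six_volumes by blast+
qed

lemma cos_bounds: "0 < 1 - cos \<phi>" "0 < 1 + cos \<phi>"
proof -
  have "(1 - cos \<phi>) * (1 + cos \<phi>) = (sin \<phi>)\<^sup>2"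
    by (simp add: sin_squared_eq algebra_simps power2_eq_square)
  then have "0 < (1 - cos \<phi>) * (1 + cos \<phi>)" using sin_nz by simp
  then show "0 < 1 - cos \<phi>" "0 < 1 + cos \<phi>"
    using cos_le_one[of \<phi>] cos_ge_minus_one[of \<phi>] by (auto simp: zero_less_mult_iff)
qed

lemma s_sq: "s\<^sup>2 = 2 * \<rho> * (1 - cos \<phi>)"
  unfolding s_def using dist_rotation_z_sq[of A1 \<phi>] by (simp add: rot \<rho>_def)

lemma s_pos: "0 < s"
proof -
  have "0 < s\<^sup>2" unfolding s_sq using rho_pos cos_bounds by simp
  then show ?thesis by (simp add: s_def)
qed

lemma s_sq_less: "s\<^sup>2 < 4 * \<rho>"
proof -
  have "0 < 2 * \<rho> * (1 + cos \<phi>)" using rho_pos cos_bounds by simp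
  then show ?thesis by (simp add: s_sq algebra_simps)
qed

lemma g_eq: "g * (\<rho> * (\<epsilon> * sin \<phi>)) = 1 - cos \<phi>" and g_pos: "0 < g"
proof -
  define r where "r = sqrt (4 * \<rho> - s\<^sup>2)"
  have r: "0 < r" "r\<^sup>2 = 2 * \<rho> * (1 + cos \<phi>)"
    using s_sq_less s_sq by (simp_all add: r_def algebra_simps)
  have abs: "\<epsilon> * sin \<phi> = \<bar>sin \<phi>\<bar>" by (simp add: \<epsilon>_def sgn_if)
  have "(s * r)\<^sup>2 = (2 * \<rho>)\<^sup>2 * (sin \<phi>)\<^sup>2"
    unfolding power_mult_distrib r s_sq sin_squared_eq by (simp add: algebra_simps power2_eq_square)
  also have "\<dots> = (2 * \<rho> * (\<epsilon> * sin \<phi>))\<^sup>2" unfolding abs by (simp add: power_mult_distrib)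
  finally have sr: "s * r = 2 * \<rho> * (\<epsilon> * sin \<phi>)"
    using s_pos r(1) rho_pos unfolding abs by (simp add: power2_eq_iff_nonneg)
  have "g * (\<rho> * (\<epsilon> * sin \<phi>)) = s / (\<rho> * r) * (s * r / 2)"
    unfolding sr by (simp add: g_def r_def)
  also have "\<dots> = s\<^sup>2 / (2 * \<rho>)"
    using r(1) by (simp add: power2_eq_square)
  finally show "g * (\<rho> * (\<epsilon> * sin \<phi>)) = 1 - cos \<phi>"
    using rho_pos by (simp add: s_sq)
  show "0 < g" using s_pos rho_pos r(1) by (simp add: g_def r_def)
qed

lemma eps_sq: "\<epsilon> * \<epsilon> = 1"
  using sin_nz by (simp add: \<epsilon>_def sgn_if)

lemma q_sq: "q\<^sup>2 = \<rho> + (a - c)\<^sup>2" and q_pos: "0 < q"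
proof -
  show q: "q\<^sup>2 = \<rho> + (a - c)\<^sup>2"
    by (simp add: q_def dist_axis_point_sq axis \<rho>_def a_def c_def)
  then have "0 < q\<^sup>2" using rho_pos by (simp add: add_pos_nonneg)
  then show "0 < q" by (simp add: q_def)
qed

lemma d_omega_BD_eq: "d_omega_BD A1 A2 B D = - 2 * g * \<epsilon> * ((b - a) * (a - d) / (b - d))"
proof -
  have "(deficit_BD A1 A2 B D has_real_derivative
     - (\<epsilon> * sgn (b - d) * (2 * g * (sgn (b - d) * (b - a) * (a - d) / (b - d))))) (at (dist B D))"
    using DERIV_dihedral_over_axis(1)[of B D s A1] axis distinct_heights s_pos s_sq_less
    unfolding deficit_BD_def[abs_def] Let_def sgn_volumes
    by (intro DERIV_minus DERIV_cmult)
       (simp add: a_def b_def c_def d_def s_def \<rho>_def g_def)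
  from DERIV_imp_deriv[OF this] show ?thesis
    using distinct_heights by (auto simp: d_omega_BD_def sgn_if)
qed

lemma d_lengths_eq:
  "d_lengths A1 B D C $ BC = - sgn (b - c)"
  "d_lengths A1 B D C $ CD = sgn (c - d)"
  "d_lengths A1 B D C $ AC = (c - a) / q"
proof -
  have z: "z_point z \<in> z_axis" "z_point z $ 3 = z" for z
    by (simp_all add: z_axis_def z_point_def)
  have abs: "((\<lambda>z. \<bar>z - k\<bar>) has_real_derivative sgn (c - k)) (at c)" if "c \<noteq> k" for k
  proof -
    have D: "((\<lambda>z. sgn (c - k) * (z - k)) has_real_derivative sgn (c - k)) (at c)"
      by (auto intro!: derivative_eq_intros)
    have "0 < sgn (c - k) * (c - k)" using that by (auto simp: sgn_if)
    from eventually_nhds_gt_of_DERIV[OF D this]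
    have "\<forall>\<^sub>F z in nhds c. \<bar>z - k\<bar> = sgn (c - k) * (z - k)"
      by eventually_elim (auto simp: sgn_if split: if_splits)
    then show ?thesis using D by (simp add: DERIV_cong_ev)
  qed
  have "d_lengths A1 B D C $ BC = deriv (\<lambda>z. \<bar>z - b\<bar>) c"
    using axis z by (simp add: d_lengths_def new_lengths_def dist_axis_points b_def c_def abs_minus_commute)
  also have "\<dots> = - sgn (b - c)"
    using DERIV_imp_deriv[OF abs[of b]] distinct_heights by (simp add: sgn_if)
  finally show "d_lengths A1 B D C $ BC = - sgn (b - c)" .
  have "d_lengths A1 B D C $ CD = deriv (\<lambda>z. \<bar>z - d\<bar>) c"
    using axis z by (simp add: d_lengths_def new_lengths_def dist_axis_points d_def c_def)
  also have "\<dots> = sgn (c - d)"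
    using DERIV_imp_deriv[OF abs[of d]] distinct_heights by simp
  finally show "d_lengths A1 B D C $ CD = sgn (c - d)" .
  have dist: "dist A1 (z_point z) = sqrt (\<rho> + (a - z)\<^sup>2)" for z
    using dist_axis_point_sq[OF z(1), of A1 z] z(2)
    by (intro real_sqrt_unique[symmetric]) (simp_all add: \<rho>_def a_def)
  have q: "sqrt (\<rho> + (a - c)\<^sup>2) = q"
    using q_sq q_pos by (intro real_sqrt_unique) auto
  have radicand: "0 < \<rho> + (a - c)\<^sup>2"
    using q_sq q_pos zero_less_power[of q 2] by simp
  have "((\<lambda>z. sqrt (\<rho> + (a - z)\<^sup>2)) has_real_derivative (c - a) / q) (at c)"
    using radicand q q_pos
    by (auto intro!: derivative_eq_intros simp: field_simps)
  then show "d_lengths A1 B D C $ AC = (c - a) / q"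
    by (simp add: d_lengths_def new_lengths_def dist DERIV_imp_deriv flip: c_def)
qed

text \<open>
  In the entry at \<open>AC\<close>, \<open>AC\<close> the terms containing \<open>4 q\<^sup>2 - s\<^sup>2\<close> from the two tetrahedra cancel:
  they come from the common face \<open>C A1 A2\<close>, and \<open>B\<close> and \<open>D\<close> enter with opposite orientation.
\<close>

lemma d_omega_new_eq:
  defines "M \<equiv> d_omega_new A1 A2 B C D"
  shows "M $ BC $ BC = - 2 * g * \<epsilon> * ((b - a) * (a - c) / (b - c))"
    and "M $ CD $ CD = - 2 * g * \<epsilon> * ((c - a) * (a - d) / (c - d))"
    and "M $ BC $ CD = 0" "M $ CD $ BC = 0"
    and "M $ BC $ AC = 2 * g * \<epsilon> * (sgn (b - c) * q * (b - a) / (b - c))"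
    and "M $ AC $ BC = 2 * g * \<epsilon> * (sgn (b - c) * q * (b - a) / (b - c))"
    and "M $ CD $ AC = 2 * g * \<epsilon> * (sgn (c - d) * q * (a - d) / (c - d))"
    and "M $ AC $ CD = 2 * g * \<epsilon> * (sgn (c - d) * q * (a - d) / (c - d))"
    and "M $ AC $ AC = 2 * g * \<epsilon> * q\<^sup>2 * (1 / (b - c) + 1 / (c - d))"
proof -
  have sq: "sgn (b - c) * (sgn (b - c) * z) = z" "sgn (c - d) * (sgn (c - d) * z) = z"
     "sgn (d - c) = - sgn (c - d)" for z
    using distinct_heights by (auto simp: sgn_if)
  note entry = M_def d_omega_new_def deficit_new_def Let_def new_lengths_def sgn_volumes
  note coord = a_def b_def c_def d_def s_def \<rho>_def q_def
  have ne: "B $ 3 \<noteq> C $ 3" "C $ 3 \<noteq> D $ 3" "D $ 3 \<noteq> C $ 3"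
    using distinct_heights by (auto simp: coord)
  have s: "0 < s" "s\<^sup>2 < 4 * axis_dist_sq A1" using s_pos s_sq_less by (simp_all add: \<rho>_def)
  note DBC = DERIV_dihedral_over_axis[OF axis(1,2) ne(1) s, folded coord, folded g_def]
  note DCD = DERIV_dihedral_over_axis[OF axis(2,3) ne(2) s, folded coord, folded g_def]
  have flip: "q * (d - a) / (d - c) = q * (a - d) / (c - d)" "q\<^sup>2 / (d - c) = - (q\<^sup>2 / (c - d))"
    using distinct_heights by (simp_all add: divide_simps algebra_simps)
  note DDC = DERIV_dihedral_over_axis[OF axis(3,2) ne(3) s, folded coord, folded g_def, unfolded flip]
  show "M $ BC $ BC = - 2 * g * \<epsilon> * ((b - a) * (a - c) / (b - c))"
    using DERIV_imp_deriv[OF DERIV_minus[OF DERIV_cmult[OF DBC(1), of "\<epsilon> * sgn (b - c)"]]]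
    by (simp add: entry sq distinct_heights mult_ac flip: s_def q_def)
  show "M $ CD $ CD = - 2 * g * \<epsilon> * ((c - a) * (a - d) / (c - d))"
    using DERIV_imp_deriv[OF DERIV_minus[OF DERIV_cmult[OF DCD(1), of "\<epsilon> * sgn (c - d)"]]]
    by (simp add: entry sq distinct_heights mult_ac flip: s_def q_def)
  show "M $ BC $ CD = 0" "M $ CD $ BC = 0"
    by (simp_all add: entry)
  show "M $ BC $ AC = 2 * g * \<epsilon> * (sgn (b - c) * q * (b - a) / (b - c))"
    using DERIV_imp_deriv[OF DERIV_minus[OF DERIV_cmult[OF DBC(3), of "\<epsilon> * sgn (b - c)"]]]
    by (simp add: entry mult_ac flip: s_def q_def)
  show "M $ CD $ AC = 2 * g * \<epsilon> * (sgn (c - d) * q * (a - d) / (c - d))"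
    using DERIV_imp_deriv[OF DERIV_minus[OF DERIV_cmult[OF DDC(2), of "\<epsilon> * sgn (c - d)"]]]
    by (simp add: entry mult_ac dist_commute[of C D] flip: s_def q_def)
  \<comment> \<open>both lifts of \<open>AC\<close> contribute the same angle, whence the repeated summands\<close>
  have twice_left: "deriv (\<lambda>t. - (k * F t + k * F t + r + r)) z = - 2 * (k * F')"
    and twice_right: "deriv (\<lambda>t. - (r + r + k * F t + k * F t)) z = - 2 * (k * F')"
    if "(F has_real_derivative F') (at z)" for F :: "real \<Rightarrow> real" and F' k r z
    using that by (auto intro!: DERIV_imp_deriv derivative_eq_intros)
  show "M $ AC $ BC = 2 * g * \<epsilon> * (sgn (b - c) * q * (b - a) / (b - c))"
    using twice_left[OF DBC(4), of "\<epsilon> * sgn (b - c)" "\<epsilon> * sgn (c - d) *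
        dihedral_of_lengths (dist A1 C) (dist A1 C) (dist C D) (dist A1 A2) (dist A1 D) (dist A1 D)"]
    by (simp add: entry mult_ac flip: s_def q_def)
  show "M $ AC $ CD = 2 * g * \<epsilon> * (sgn (c - d) * q * (a - d) / (c - d))"
    using twice_right[OF DDC(4), of "\<epsilon> * sgn (b - c) *
        dihedral_of_lengths (dist A1 C) (dist A1 C) (dist B C) (dist A1 A2) (dist A1 B) (dist A1 B)"
        "\<epsilon> * sgn (c - d)"]
    by (simp add: entry mult_ac dist_commute[of C D] flip: s_def q_def)
  have "M $ AC $ AC = - 2 * (\<epsilon> * sgn (b - c) * (- g * sgn (b - c) *
          (q\<^sup>2 / (b - c) - (a - c) * (1 + 4 * \<rho> / (4 * q\<^sup>2 - s\<^sup>2)))))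
      - 2 * (\<epsilon> * sgn (c - d) * (- g * sgn (d - c) *
          (- (q\<^sup>2 / (c - d)) - (a - c) * (1 + 4 * \<rho> / (4 * q\<^sup>2 - s\<^sup>2)))))"
  proof -
    have "deriv (\<lambda>t. - (k * F t + k * F t + r * G t + r * G t)) z = - 2 * (k * F') - 2 * (r * G')"
      if "(F has_real_derivative F') (at z)" "(G has_real_derivative G') (at z)"
      for F G :: "real \<Rightarrow> real" and F' G' k r z
      using that by (auto intro!: DERIV_imp_deriv derivative_eq_intros)
    from this[OF DBC(5) DDC(5), of "\<epsilon> * sgn (b - c)" "\<epsilon> * sgn (c - d)"]
    show ?thesis by (simp add: entry mult.assoc dist_commute[of C D] flip: s_def q_def)
  qed
  also have "\<dots> = 2 * g * \<epsilon> * (q\<^sup>2 / (b - c) + q\<^sup>2 / (c - d))"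
    by (simp add: sq(3) distinct_heights algebra_simps)
  also have "\<dots> = 2 * g * \<epsilon> * q\<^sup>2 * (1 / (b - c) + 1 / (c - d))"
    by (simp add: divide_inverse algebra_simps)
  finally show "M $ AC $ AC = 2 * g * \<epsilon> * q\<^sup>2 * (1 / (b - c) + 1 / (c - d))" .
qed

lemma transpose_d_omega_new:
  "transpose (d_omega_new A1 A2 B C D) = d_omega_new A1 A2 B C D"
proof -
  have "d_omega_new A1 A2 B C D $ i $ j = d_omega_new A1 A2 B C D $ j $ i" for i j
    by (cases i; cases j) (simp_all add: d_omega_new_eq)
  then show ?thesis by (simp add: transpose_def vec_eq_iff)
qed

text \<open>
  A displacement of \<open>C\<close> along the axis yields lengths of an actual configuration again, with all
  deficit angles unchanged.
\<close>

lemma d_omega_new_d_lengths: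
  "d_omega_new A1 A2 B C D *v d_lengths A1 B D C = 0"
proof -
  define eB eD where "eB = sgn (b - c)" and "eD = sgn (c - d)"
  have e: "eB * eB = 1" "eD * eD = 1"
    using distinct_heights by (auto simp: eB_def eD_def sgn_if)
  have quot: "q * ((c - a) / q) = c - a" using q_pos by simp_all
  have nz: "b - c \<noteq> 0" "c - d \<noteq> 0" using distinct_heights by auto
  have row: "(d_omega_new A1 A2 B C D *v d_lengths A1 B D C) $ i
      = - (d_omega_new A1 A2 B C D $ i $ BC * eB) + d_omega_new A1 A2 B C D $ i $ CD * eD
        + d_omega_new A1 A2 B C D $ i $ AC * ((c - a) / q)" for i
    by (simp add: matrix_vector_mult_def UNIV_new_edge d_lengths_eq eB_def eD_def algebra_simps)
  have "(d_omega_new A1 A2 B C D *v d_lengths A1 B D C) $ i = 0" for i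
  proof (cases i)
    case BC
    have "(d_omega_new A1 A2 B C D *v d_lengths A1 B D C) $ BC
      = 2 * g * \<epsilon> * eB * ((b - a) / (b - c)) * ((a - c) + q * ((c - a) / q))"
      unfolding row d_omega_new_eq eB_def[symmetric] by (simp add: divide_inverse algebra_simps)
    then show ?thesis unfolding BC quot by simp
  next
    case CD
    have "(d_omega_new A1 A2 B C D *v d_lengths A1 B D C) $ CD
      = 2 * g * \<epsilon> * eD * ((a - d) / (c - d)) * ((a - c) + q * ((c - a) / q))"
      unfolding row d_omega_new_eq eD_def[symmetric] by (simp add: divide_inverse algebra_simps)
    then show ?thesis unfolding CD quot by simp
  next
    case AC
    have "(d_omega_new A1 A2 B C D *v d_lengths A1 B D C) $ AC
      = 2 * g * \<epsilon> * q * (- (eB * eB) * (b - a) / (b - c) + eD * eD * (a - d) / (c - d)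
          + (1 / (b - c) + 1 / (c - d)) * (q * ((c - a) / q)))"
      unfolding row d_omega_new_eq eB_def[symmetric] eD_def[symmetric]
      by (simp add: divide_inverse algebra_simps power2_eq_square)
    also have "\<dots> = 2 * g * \<epsilon> * q * ((c - d) * inverse (c - d) - (b - c) * inverse (b - c))"
      unfolding e quot unfolding divide_inverse by algebra
    also have "\<dots> = 0" using nz by simp
    finally show ?thesis unfolding AC .
  qed
  then show ?thesis by (simp add: vec_eq_iff)
qed

section \<open>The ratio of torsions\<close>

text \<open>
  Acyclicity of the first complex says that \<open>A\<close> lies at neither of the heights of \<open>B\<close> and \<open>D\<close>, which
  is exactly the condition for \<open>\<kappa>\<close> to be nonzero.
\<close>

lemma acyclic_2_and_torsion_ratio:
  assumes "acyclic_1 (d_omega_BD A1 A2 B D)"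
  shows "acyclic_2 (d_lengths A1 B D C) (d_omega_new A1 A2 B C D)"
    and "d_lengths A1 B D C $ e \<noteq> 0 \<Longrightarrow>
      torsion_2 (d_lengths A1 B D C) (d_omega_new A1 A2 B C D) e / torsion_1 (d_omega_BD A1 A2 B D)
      = (6 * oriented_volume C A1 A2 B) * (6 * oriented_volume D A1 A2 C)
        / (2 * (1 - cos \<phi>) * (dist A1 C)\<^sup>2 * (6 * oriented_volume D A1 A2 B))"
proof -
  define M v where "M = d_omega_new A1 A2 B C D" and "v = d_lengths A1 B D C"
  define \<kappa> where "\<kappa> = - 4 * g\<^sup>2 * q\<^sup>2 * ((b - a) * (a - d)) / ((b - c) * (c - d))"
  have "d_omega_BD A1 A2 B D \<noteq> 0"
  proof
    assume "d_omega_BD A1 A2 B D = 0"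
    then have "inj (\<lambda>t::real. 0 * t)" using assms by (simp add: acyclic_1_def bij_def)
    then show False by (auto dest: injD[of _ 0 1])
  qed
  then have ne: "b - a \<noteq> 0" "a - d \<noteq> 0" unfolding d_omega_BD_eq by auto
  have nz: "b - c \<noteq> 0" "c - d \<noteq> 0" "b - d \<noteq> 0" using distinct_heights by auto
  have v: "v $ BC \<noteq> 0" "v $ CD \<noteq> 0"
    using nz by (simp_all add: v_def d_lengths_eq sgn_eq_0_iff)
  have \<kappa>: "M $ BC $ AC * M $ CD $ AC / (v $ BC * v $ CD) = \<kappa>"
  proof -
    have "(2 * g * \<epsilon> * (k * q * (b - a) / (b - c))) * (2 * g * \<epsilon> * (l * q * (a - d) / (c - d)))
        / (- k * l) = (\<epsilon> * \<epsilon>) * \<kappa>" if "k \<noteq> 0" "l \<noteq> 0" for k l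
      unfolding \<kappa>_def using that by (simp add: power2_eq_square)
    then show ?thesis
      using v by (simp add: M_def v_def d_omega_new_eq d_lengths_eq eps_sq)
  qed
  have minors: "minor_of_others M x = \<kappa> * (v $ x)\<^sup>2" for x
    unfolding torsion_minors[OF transpose_d_omega_new d_omega_new_d_lengths d_omega_new_eq(3),
        folded M_def v_def, OF v] \<kappa> ..
  have "\<kappa> \<noteq> 0"
    unfolding \<kappa>_def using ne nz g_pos q_pos by simp
  then show "acyclic_2 (d_lengths A1 B D C) (d_omega_new A1 A2 B C D)"
    using acyclic_2I[OF transpose_d_omega_new d_omega_new_d_lengths] minors[of BC] v
    by (simp add: M_def v_def)
  assume "d_lengths A1 B D C $ e \<noteq> 0"
  then have "torsion_2 (d_lengths A1 B D C) (d_omega_new A1 A2 B C D) e / torsion_1 (d_omega_BD A1 A2 B D)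
      = d_omega_BD A1 A2 B D / \<kappa>"
    using minors[of e] by (simp add: torsion_2_def torsion_1_def M_def v_def divide_inverse)
  also have "\<dots> = \<epsilon> * ((b - c) * (c - d)) / (2 * g * q\<^sup>2 * (b - d))"
  proof -
    have ratio: "- 2 * g * \<epsilon> * (x / z) / (- 4 * g\<^sup>2 * q\<^sup>2 * x / w) = \<epsilon> * w / (2 * g * q\<^sup>2 * z)"
      if "x \<noteq> 0" "z \<noteq> 0" "w \<noteq> 0" for x z w
      using that g_pos q_pos by (simp add: divide_simps power2_eq_square)
    show ?thesis
      unfolding d_omega_BD_eq \<kappa>_def by (rule ratio) (use ne nz in simp_all)
  qed
  also have "\<dots> = (b - c) * (c - d) * (\<rho> * sin \<phi>) / (2 * (1 - cos \<phi>) * q\<^sup>2 * (b - d))"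
  proof -
    have "\<epsilon> * (1 - cos \<phi>) = g * (\<rho> * sin \<phi>)"
      unfolding g_eq[symmetric] using eps_sq by algebra
    then show ?thesis
      using nz g_pos q_pos cos_bounds by (simp add: frac_eq_eq) algebra
  qed
  also have "\<dots> = ((b - c) * \<rho> * sin \<phi>) * ((c - d) * \<rho> * sin \<phi>)
      / (2 * (1 - cos \<phi>) * q\<^sup>2 * ((b - d) * \<rho> * sin \<phi>))"
    using rho_pos sin_nz by simp
  finally show "torsion_2 (d_lengths A1 B D C) (d_omega_new A1 A2 B C D) e / torsion_1 (d_omega_BD A1 A2 B D)
      = (6 * oriented_volume C A1 A2 B) * (6 * oriented_volume D A1 A2 C)
        / (2 * (1 - cos \<phi>) * (dist A1 C)\<^sup>2 * (6 * oriented_volume D A1 A2 B))"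
    unfolding six_volumes q_def .
qed

end

theorem mainTheorem2:
  fixes \<phi> :: real and A1 A2 B C D :: "real^3"
  assumes phi: "\<not> (\<exists>k::int. \<phi> = 2 * pi * of_int k)"
    and axis: "B \<in> z_axis" "C \<in> z_axis" "D \<in> z_axis"
    and rot: "A2 = rotation_z \<phi> A1"
    and vol_BDAA: "oriented_volume D A1 A2 B \<noteq> 0"
    and vol_BCAA: "oriented_volume C A1 A2 B \<noteq> 0"
    and vol_CDAA: "oriented_volume D A1 A2 C \<noteq> 0"
    and acyclic: "acyclic_1 (d_omega_BD A1 A2 B D)"
  shows "acyclic_2 (d_lengths A1 B D C) (d_omega_new A1 A2 B C D) \<and>
    (\<forall>a. d_lengths A1 B D C $ a \<noteq> 0 \<longrightarrow>
      torsion_2 (d_lengths A1 B D C) (d_omega_new A1 A2 B C D) a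
        / torsion_1 (d_omega_BD A1 A2 B D)
      = (6 * oriented_volume C A1 A2 B) * (6 * oriented_volume D A1 A2 C)
        / (2 * (1 - cos \<phi>) * (dist A1 C)\<^sup>2 * (6 * oriented_volume D A1 A2 B)))"
proof -
  interpret axis_configuration \<phi> A1 A2 B C D
    using axis rot vol_BDAA vol_BCAA vol_CDAA by unfold_locales
  show ?thesis
    using acyclic_2_and_torsion_ratio[OF acyclic] by blast
qed

end
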